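(* Let $x,y,\nu,p\in\mathbb{C}$ with $\Re(p)>0$. Then $$B_{\nu}(x,1-y;p)= \sum_{n=0}^\infty \frac{(y)_n}{n!}\, B_{\nu}(x+n,1;p).$$
   Context: $K_\mu(z)$ denotes the modified Bessel function of the second kind of order $\mu$. $(y)_n$ is the Pochhammer symbol: $(y)_0=1$, $(y)_n=y(y+1)\cdots(y+n-1)$. For $x,y,\nu\in\mathbb{C}$ and $\Re(p)>0$ the extended Beta function is $$B_{\nu}(x,y;p):= \sqrt{\frac{2p}{\pi}}\int_{0}^{1} t^{x-\frac{3}{2}}(1-t)^{y-\frac{3}{2}}\, K_{\nu+\frac{1}{2}}\left(\frac{p}{t(1-t)}\right)dt .$$ Square roots take principal values. *)

theory Defs
  imports "HOL-Analysis.Analysis"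
begin

definition besselI :: "complex \<Rightarrow> complex \<Rightarrow> complex" where
  "besselI \<mu> z = (z / 2) powr \<mu> * (\<Sum>k. (z\<^sup>2 / 4) ^ k * rGamma (\<mu> + of_nat k + 1) / fact k)"

text \<open>For integer order the quotient defining \<open>K\<close> has a removable singularity as a function of
  the order; the value there is the limit.\<close>

definition besselK :: "complex \<Rightarrow> complex \<Rightarrow> complex" where
  "besselK \<mu> z =
    (let Q = (\<lambda>s. of_real pi / 2 * (besselI (- s) z - besselI s z) / sin (s * of_real pi))
     in if \<mu> \<in> \<int> then Lim (at \<mu>) Q else Q \<mu>)"

definition ext_Beta :: "complex \<Rightarrow> complex \<Rightarrow> complex \<Rightarrow> complex \<Rightarrow> complex" where
  "ext_Beta \<nu> x y p = csqrt (2 * p / of_real pi) *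
    (LBINT t:{0<..<1}. of_real t powr (x - 3 / 2) * of_real (1 - t) powr (y - 3 / 2) *
       besselK (\<nu> + 1 / 2) (p / of_real (t * (1 - t))))"

end

theory Submission
  imports Defs
begin

text \<open>
  Expanding \<open>(1 - t) powr (- y)\<close> in powers of \<open>t\<close> under the integral gives the series; the
  partial sums are dominated by \<open>(1 - t) powr (- \<bar>y\<bar>)\<close>, so the interchange only needs that \<open>K\<close>
  decays exponentially along rays in the right half-plane. This is read off the representation
  \<open>K\<^sub>s(z) = \<Phi>\<^sub>s(z)\<close> with \<open>\<Phi>\<^sub>s(z) = 1/2 \<integral> exp (- z cosh u - s u) du\<close> over the real line, \<open>Re z > 0\<close>.

  To obtain it from the definition through \<open>I\<^sub>s\<close> and \<open>I\<^sub>-\<^sub>s\<close>, put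
  \<open>W\<^sub>s = z (I\<^sub>s \<Phi>\<^sub>s\<^sub>+\<^sub>1 + I\<^sub>s\<^sub>+\<^sub>1 \<Phi>\<^sub>s)\<close>. The first-order differential relations make \<open>W\<^sub>s\<close> constant in \<open>z\<close>,
  the behaviour at \<open>0\<close> gives \<open>W\<^sub>s = 1\<close> for \<open>Re s > 0\<close>, and the three-term recurrences give
  \<open>W\<^sub>s = W\<^sub>s\<^sub>+\<^sub>1\<close>, so \<open>W\<^sub>s = 1\<close> for every \<open>s\<close>. Eliminating \<open>\<Phi>\<^sub>s\<^sub>+\<^sub>1\<close> from \<open>W\<^sub>s = 1\<close> and
  \<open>W\<^sub>-\<^sub>s\<^sub>-\<^sub>1 = 1\<close> and inserting the Wronskian of \<open>I\<^sub>s\<close> and \<open>I\<^sub>-\<^sub>s\<close> expresses \<open>\<Phi>\<^sub>s\<close> by \<open>I\<^sub>-\<^sub>s - I\<^sub>s\<close>.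
  Integer orders follow by continuity of \<open>\<Phi>\<close> in \<open>s\<close>.
\<close>

section \<open>The function \<open>I\<close>\<close>

text \<open>The entire factor of \<open>besselI\<close>, in the variable \<open>w = z^2 / 4\<close>.
  With the branch-dependent power split off, what remains is continuous at the origin, where the
  constants below are evaluated.\<close>

definition bessel_series :: "complex \<Rightarrow> complex \<Rightarrow> complex" where
  "bessel_series s w = (\<Sum>k. rGamma (s + of_nat k + 1) / fact k * w ^ k)"

lemma summable_bessel_series:
  fixes s w :: complex
  shows "summable (\<lambda>k. rGamma (s + of_nat k + 1) / fact k * w ^ k)"
proof (rule summable_ratio_test)
  \<comment> \<open>From this index on \<open>norm (s + k + 1) >= 1\<close> and
    \<open>k + 1 >= 2 * norm w\<close>, so the term ratio \<open>w / ((k + 1) (s + k + 1))\<close>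
    has norm at most 1/2.\<close>
  define N where "N = nat \<lceil>norm s + 2 * norm w\<rceil>"
  show "(1/2 :: real) < 1" by simp
  fix k assume k: "k \<ge> N"
  have kN: "real k \<ge> norm s + 2 * norm w"
    using k unfolding N_def by linarith
  define g where "g = rGamma (s + of_nat k + 2)"
  have rec: "rGamma (s + of_nat k + 1) = (s + of_nat k + 1) * g"
    using rGamma_plus1[of "s + of_nat k + 1"] by (simp add: g_def add_ac)
  have "real k + 1 \<le> norm (s + of_nat k + 1) + norm s"
    using norm_triangle_ineq[of "s + of_nat k + 1" "- s"]
    by (simp add: add_ac flip: of_nat_Suc)
  hence n1: "1 \<le> norm (s + of_nat k + 1)"
    using kN norm_ge_zero[of w] by linarith
  have n2: "2 * norm w \<le> real (Suc k)"
    using kN norm_ge_zero[of s] unfolding of_nat_Suc by linarith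
  have "norm (rGamma (s + of_nat (Suc k) + 1) / fact (Suc k) * w ^ Suc k) =
        norm g * norm w * norm w ^ k / (real (Suc k) * fact k)"
  proof -
    have "rGamma (s + of_nat (Suc k) + 1) = g" by (simp add: g_def add_ac)
    thus ?thesis
      by (simp add: norm_mult norm_divide norm_power fact_Suc del: of_nat_Suc)
  qed
  also have "\<dots> = norm w / real (Suc k) * (norm g * norm w ^ k / fact k)"
    by (simp del: of_nat_Suc)
  also have "\<dots> \<le> 1/2 * (norm g * norm w ^ k / fact k)"
    using n2 by (intro mult_right_mono) (auto simp: field_simps)
  also have "\<dots> \<le> 1/2 * (norm (s + of_nat k + 1) * norm g * norm w ^ k / fact k)"
    using n1 by (intro mult_left_mono divide_right_mono mult_right_mono) (auto intro: mult_le_cancel_right1[THEN iffD2])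
  also have "\<dots> = 1/2 * norm (rGamma (s + of_nat k + 1) / fact k * w ^ k)"
    by (simp add: norm_mult norm_divide norm_power rec)
  finally show "norm (rGamma (s + of_nat (Suc k) + 1) / fact (Suc k) * w ^ Suc k) \<le>
      1/2 * norm (rGamma (s + of_nat k + 1) / fact k * w ^ k)" .
qed

text \<open>Termwise differentiation cancels one factor of the factorial and shifts the index, which
  amounts to raising the order by one.\<close>

lemma DERIV_bessel_series:
  "(bessel_series s has_field_derivative bessel_series (s + 1) w) (at w)"
proof -
  have "diffs (\<lambda>k. rGamma (s + of_nat k + 1) / fact k) =
        (\<lambda>k. rGamma (s + 1 + of_nat k + 1) / fact k)"
    by (rule ext) (simp add: diffs_def field_simps del: of_nat_Suc, simp add: add_ac)
  thus ?thesis
    using termdiffs_strong_converges_everywhere[OF summable_bessel_series[of s], of w]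
    by (simp add: bessel_series_def[abs_def])
qed

lemma isCont_bessel_series: "isCont (bessel_series s) w"
  using DERIV_bessel_series DERIV_isCont by blast

lemma bessel_series_0: "bessel_series s 0 = rGamma (s + 1)"
  unfolding bessel_series_def by (subst powser_zero) simp

text \<open>Coefficientwise this is \<open>(s + k) rGamma (s + k + 1) = rGamma (s + k)\<close>: the
  part with \<open>s\<close> gives the first summand; the part with \<open>k\<close> cancels against
  \<open>fact k\<close> and, after an index shift, gives the second.\<close>

lemma bessel_series_rec:
  "bessel_series (s - 1) w = s * bessel_series s w + w * bessel_series (s + 1) w"
proof -
  let ?c = "\<lambda>s k. rGamma (s + of_nat k + 1) / fact k * w ^ k"
  have "(\<lambda>k. w * ?c (s + 1) k) sums (w * bessel_series (s + 1) w)"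
    unfolding bessel_series_def by (intro sums_mult summable_sums summable_bessel_series)
  also have "(\<lambda>k. w * ?c (s + 1) k) = (\<lambda>k. of_nat (Suc k) * ?c s (Suc k))"
    by (rule ext) (simp add: field_simps del: of_nat_Suc, simp add: add_ac)
  finally have 1: "(\<lambda>k. of_nat k * ?c s k) sums (w * bessel_series (s + 1) w)"
    by (subst (asm) sums_Suc_iff) simp
  have "(\<lambda>k. s * ?c s k) sums (s * bessel_series s w)"
    unfolding bessel_series_def by (intro sums_mult summable_sums summable_bessel_series)
  from sums_add[OF this 1] have "(\<lambda>k. (s + of_nat k) * ?c s k) sums
      (s * bessel_series s w + w * bessel_series (s + 1) w)"
    by (simp only: ring_distribs)
  also have "(\<lambda>k. (s + of_nat k) * ?c s k) = ?c (s - 1)"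
  proof
    fix k
    show "(s + of_nat k) * ?c s k = ?c (s - 1) k"
      using rGamma_plus1[of "s + of_nat k"] by (simp flip: mult.assoc)
  qed
  finally show ?thesis
    unfolding bessel_series_def[of "s - 1"] by (simp add: sums_iff)
qed

lemma besselI_eq: "besselI s z = (z / 2) powr s * bessel_series s (z\<^sup>2 / 4)"
  unfolding besselI_def bessel_series_def by (simp add: mult_ac)

section \<open>Recurrence and first-order relations for \<open>besselI\<close>\<close>

lemma besselI_rec:
  assumes "z \<noteq> 0"
  shows "besselI (s - 1) z - besselI (s + 1) z = 2 * s / z * besselI s z"
proof -
  have "besselI (s - 1) z =
          (z / 2) powr (s - 1) * (s * bessel_series s (z\<^sup>2 / 4) + z\<^sup>2 / 4 * bessel_series (s + 1) (z\<^sup>2 / 4))"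
    by (simp add: besselI_eq bessel_series_rec)
  also have "(z / 2) powr (s - 1) = (z / 2) powr s * (2 / z)"
    using assms by (simp add: powr_diff)
  finally have 1: "besselI (s - 1) z = (z / 2) powr s * (2 / z) *
      (s * bessel_series s (z\<^sup>2 / 4) + z\<^sup>2 / 4 * bessel_series (s + 1) (z\<^sup>2 / 4))" .
  have 2: "(z / 2) powr (s + 1) = (z / 2) powr s * (z / 2)"
    using assms by (simp add: powr_add)
  show ?thesis
    unfolding 1 besselI_eq[of "s + 1"] besselI_eq[of s] 2 using assms
    by (simp add: field_simps power2_eq_square)
qed

lemma DERIV_besselI:
  assumes "Re z > 0"
  shows "(besselI s has_field_derivative besselI (s + 1) z + s / z * besselI s z) (at z)"
proof -
  have z: "z \<noteq> 0" "z / 2 \<notin> \<real>\<^sub>\<le>\<^sub>0"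
    using assms by (auto simp: complex_nonpos_Reals_iff)
  have "((\<lambda>z. (z / 2) powr s * bessel_series s (z\<^sup>2 / 4)) has_field_derivative
          s * (z / 2) powr (s - 1) * (1 / 2) * bessel_series s (z\<^sup>2 / 4)
          + bessel_series (s + 1) (z\<^sup>2 / 4) * (z / 2) * (z / 2) powr s) (at z)"
    using z
    by (auto intro!: derivative_eq_intros DERIV_chain2[OF DERIV_bessel_series])
  moreover have "(z / 2) powr (s - 1) = (z / 2) powr s * (2 / z)"
    using z by (simp add: powr_diff)
  ultimately show ?thesis
    using z by (simp add: besselI_eq[abs_def] powr_add field_simps)
qed

text \<open>The lowering companion of \<open>DERIV_besselI\<close>: the recurrence trades order
  \<open>s + 2\<close> for order \<open>s\<close>. Differentiation thus stays within the orders
  \<open>s\<close> and \<open>s + 1\<close>.\<close>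

lemma DERIV_besselI':
  assumes "Re z > 0"
  shows "(besselI (s + 1) has_field_derivative besselI s z - (s + 1) / z * besselI (s + 1) z) (at z)"
proof -
  have "z \<noteq> 0" using assms by auto
  from besselI_rec[OF this, of "s + 1"]
  have "besselI s z - (s + 1) / z * besselI (s + 1) z = besselI (s + 1 + 1) z + (s + 1) / z * besselI (s + 1) z"
    by (simp add: field_simps \<open>z \<noteq> 0\<close>)
  with DERIV_besselI[OF assms, of "s + 1"] show ?thesis by (simp only:)
qed

text \<open>The half-plane is convex, so \<open>W\<close> is constant on it, and the approach to 0
  along the positive axis identifies the constant. Both Wronskian evaluations use this.\<close>

lemma half_plane_DERIV_zero_const:
  assumes "\<And>z. Re z > 0 \<Longrightarrow> (W has_field_derivative 0) (at z)"
    and lim: "((\<lambda>x. W (of_real x)) \<longlongrightarrow> L) (at_right (0 :: real))"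
    and z: "Re z > 0"
  shows "W z = (L :: complex)"
proof -
  have "convex {z. Re z > 0}" by (rule convex_halfspace_Re_gt)
  then obtain c where c: "\<And>z. Re z > 0 \<Longrightarrow> W z = c"
    using has_field_derivative_zero_constant[of "{z. Re z > 0}" W]
      assms(1) has_field_derivative_at_within by blast
  have "eventually (\<lambda>x::real. c = W (of_real x)) (at_right 0)"
    using eventually_at_right_less[of 0] by eventually_elim (simp add: c)
  hence "((\<lambda>x. W (of_real x)) \<longlongrightarrow> c) (at_right (0 :: real))"
    by (rule tendsto_cong[THEN iffD1, rotated, OF tendsto_const])
  with lim have "L = c" using tendsto_unique[OF trivial_limit_at_right_real] by blast
  with c z show ?thesis by simp
qed

text \<open>The left side is \<open>- z\<close> times the Wronskian of the orders \<open>s\<close>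
  and \<open>- s\<close>, with derivatives eliminated. It is constant, and the reflection formula
  for \<open>rGamma\<close> evaluates its limit at 0.\<close>

lemma besselI_Wronskian:
  assumes "Re z > 0"
  shows "z * (besselI (s + 1) z * besselI (- s) z - besselI (- s - 1) z * besselI s z) =
         2 * sin (of_real pi * s) / of_real pi"
proof -
  define W where "W = (\<lambda>z. z * (besselI (s + 1) z * besselI (- s) z - besselI (- s - 1) z * besselI s z))"
  show ?thesis
    unfolding W_def[symmetric, THEN fun_cong]
  proof (rule half_plane_DERIV_zero_const[OF _ _ assms])
    fix z :: complex assume z: "Re z > 0"
    hence z0: "z \<noteq> 0" by auto
    \<comment> \<open>The orders \<open>- s - 1\<close> and \<open>- s\<close> are again
      consecutive, so the same two relations differentiate all four factors.\<close>
    note d = DERIV_besselI[OF z, of s] DERIV_besselI'[OF z, of s]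
      DERIV_besselI[OF z, of "- s - 1", simplified] DERIV_besselI'[OF z, of "- s - 1", simplified]
    show "(W has_field_derivative 0) (at z)"
      unfolding W_def
      by (rule derivative_eq_intros d refl)+ (use z0 in \<open>simp add: field_simps\<close>)
  next
    \<comment> \<open>In each product the powers of \<open>x / 2\<close> combine to an integer
      power; with the prefactor \<open>x\<close>, only functions continuous at 0 remain, and the
      first product vanishes there.\<close>
    have eq: "W (of_real x) = of_real (x\<^sup>2 / 2) * bessel_series (s + 1) (of_real (x\<^sup>2 / 4)) *
          bessel_series (- s) (of_real (x\<^sup>2 / 4)) -
          2 * bessel_series (- s - 1) (of_real (x\<^sup>2 / 4)) * bessel_series s (of_real (x\<^sup>2 / 4))"
      if "x > 0" for x
    proof -
      have "(of_real x / 2 :: complex) powr (s + 1) * (of_real x / 2) powr (- s) = of_real x / 2"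
           "(of_real x / 2 :: complex) powr (- s - 1) * (of_real x / 2) powr s = 2 / of_real x"
        using that powr_add[of "of_real x / 2 :: complex" "s + 1" "- s"]
          powr_add[of "of_real x / 2 :: complex" "- s - 1" s]
        by (simp_all add: powr_minus)
      hence *: "(of_real x / 2 :: complex) powr (s + 1) * u * ((of_real x / 2) powr (- s) * v) = of_real x / 2 * (u * v)"
        "(of_real x / 2 :: complex) powr (- s - 1) * u * ((of_real x / 2) powr s * v) = 2 / of_real x * (u * v)" for u v
        by (simp_all only: mult_ac)
      show ?thesis
        unfolding W_def besselI_eq * using that by (simp add: power2_eq_square field_simps)
    qed
    have "((\<lambda>x::real. of_real (x\<^sup>2 / 2) * bessel_series (s + 1) (of_real (x\<^sup>2 / 4)) *
          bessel_series (- s) (of_real (x\<^sup>2 / 4)) -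
          2 * bessel_series (- s - 1) (of_real (x\<^sup>2 / 4)) * bessel_series s (of_real (x\<^sup>2 / 4)))
          \<longlongrightarrow> of_real (0\<^sup>2 / 2) * bessel_series (s + 1) (of_real (0\<^sup>2 / 4)) *
          bessel_series (- s) (of_real (0\<^sup>2 / 4)) -
          2 * bessel_series (- s - 1) (of_real (0\<^sup>2 / 4)) * bessel_series s (of_real (0\<^sup>2 / 4))) (at_right 0)"
      by (intro tendsto_intros isCont_tendsto_compose[OF isCont_bessel_series]) simp_all
    also have "of_real (0\<^sup>2 / 2) * bessel_series (s + 1) (of_real (0\<^sup>2 / 4)) *
          bessel_series (- s) (of_real (0\<^sup>2 / 4)) -
          2 * bessel_series (- s - 1) (of_real (0\<^sup>2 / 4)) * bessel_series s (of_real (0\<^sup>2 / 4)) =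
        - 2 * (rGamma (- s) * rGamma (1 - (- s)))"
      by (simp add: bessel_series_0 add_ac)
    also have "\<dots> = 2 * sin (of_real pi * s) / of_real pi"
      by (subst rGamma_reflection_complex) simp
    finally show "((\<lambda>x. W (of_real x)) \<longlongrightarrow> 2 * sin (of_real pi * s) / of_real pi) (at_right 0)"
      by (rule Lim_transform_eventually)
         (use eventually_at_right_less[of 0] in \<open>eventually_elim, simp add: eq\<close>)
  qed
qed

section \<open>The integral representing \<open>K\<close>\<close>

lemma integrable_exp_minus_abs:
  assumes "c > 0"
  shows "integrable lborel (\<lambda>u :: real. exp (- c * \<bar>u\<bar>))"
proof -
  have "set_integrable lebesgue {0..} (\<lambda>u :: real. exp (- c * u))"
    by (rule nonnegative_absolutely_integrable_1[OF integrable_on_exp_minus_to_infinity[OF assms]]) auto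
  hence "integrable lebesgue (\<lambda>u :: real. indicator {0..} u *\<^sub>R exp (- c * \<bar>u\<bar>))"
    unfolding set_integrable_def
    by (rule back_subst) (auto intro!: Bochner_Integration.integrable_cong simp: indicator_def)
  hence "integrable lborel (\<lambda>u :: real. indicator {0..} u *\<^sub>R exp (- c * \<bar>u\<bar>))"
    by (subst (asm) integrable_completion) auto
  from has_bochner_integral_even_function[OF has_bochner_integral_integrable[OF this]]
  show ?thesis by (auto dest: integrable.intros)
qed

lemma cosh_ge_quarter_square: "u\<^sup>2 / 4 \<le> cosh (u :: real)"
proof -
  have "u\<^sup>2 / 2 \<le> exp \<bar>u\<bar>"
    using exp_lower_Taylor_quadratic[of "\<bar>u\<bar>"] by simp
  also have "exp \<bar>u\<bar> \<le> exp u + exp (- u)"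
    by (simp add: abs_if)
  finally show ?thesis
    by (simp add: cosh_field_def)
qed

text \<open>With \<open>u^2 / 4 <= cosh u\<close> the claim follows from completing a square. The
  linear rate \<open>m + 1\<close>, one more than needed to absorb \<open>m\<close>, leaves the
  decay \<open>exp (- 1 * \<bar>u\<bar>)\<close>.\<close>

lemma exp_minus_cosh_le:
  fixes a m u :: real
  assumes "a > 0"
  shows "exp (- a * cosh u + m * \<bar>u\<bar>) \<le> exp ((m + 1)\<^sup>2 / a) * exp (- 1 * \<bar>u\<bar>)"
proof -
  have square: "(a * v - 2 * n)\<^sup>2 / (4 * a) = a * (v\<^sup>2 / 4) - n * v + n\<^sup>2 / a" for v n
    using assms by (simp add: field_simps power2_eq_square)
  have "0 \<le> (a * \<bar>u\<bar> - 2 * (m + 1))\<^sup>2 / (4 * a)"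
    using assms by simp
  also have "\<dots> = a * (u\<^sup>2 / 4) - (m + 1) * \<bar>u\<bar> + (m + 1)\<^sup>2 / a"
    unfolding square by simp
  also have "\<dots> \<le> a * cosh u - (m + 1) * \<bar>u\<bar> + (m + 1)\<^sup>2 / a"
    using assms cosh_ge_quarter_square[of u]
    by (intro add_right_mono diff_right_mono mult_left_mono) auto
  finally show ?thesis
    by (simp add: algebra_simps flip: exp_add)
qed

lemma integrable_exp_minus_cosh:
  assumes "a > 0"
  shows "integrable lborel (\<lambda>u :: real. exp (- a * cosh u + m * \<bar>u\<bar>))"
proof (rule Bochner_Integration.integrable_bound)
  show "integrable lborel (\<lambda>u :: real. exp ((m + 1)\<^sup>2 / a) * exp (- 1 * \<bar>u\<bar>))"
    by (intro integrable_mult_right integrable_exp_minus_abs) simp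
  show "AE u in lborel. norm (exp (- a * cosh u + m * \<bar>u\<bar>)) \<le>
          norm (exp ((m + 1)\<^sup>2 / a) * exp (- 1 * \<bar>u\<bar>))"
    using exp_minus_cosh_le[OF assms, of _ m] by (simp add: abs_mult)
qed (auto intro!: borel_measurable_continuous_onI continuous_intros)

lemma cosh_le_exp_abs: "cosh (u :: real) \<le> exp \<bar>u\<bar>"
proof -
  have "exp u \<le> exp \<bar>u\<bar>" "exp (- u) \<le> exp \<bar>u\<bar>" by auto
  hence "exp u + exp (- u) \<le> 2 * exp \<bar>u\<bar>" by linarith
  thus ?thesis by (simp add: cosh_field_def)
qed

text \<open>Using \<open>exp (- s u)\<close> on the whole line, rather than
  \<open>cosh (s u)\<close> on a half-line, makes a shift of the order by one a multiplication by
  \<open>exp (- u)\<close> or \<open>exp u\<close>.\<close>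

definition besselK_kernel :: "complex \<Rightarrow> complex \<Rightarrow> real \<Rightarrow> complex" where
  "besselK_kernel s z u = exp (- z * of_real (cosh u) - s * of_real u)"

definition besselK_integral :: "complex \<Rightarrow> complex \<Rightarrow> complex" where
  "besselK_integral s z = (LBINT u. besselK_kernel s z u) / 2"

lemma norm_besselK_kernel_le:
  "norm (besselK_kernel s z u) \<le> exp (- Re z * cosh u + \<bar>Re s\<bar> * \<bar>u\<bar>)"
proof -
  have "- (Re s * u) \<le> \<bar>Re s\<bar> * \<bar>u\<bar>"
    by (metis abs_ge_self abs_minus_cancel abs_mult)
  thus ?thesis by (simp add: besselK_kernel_def)
qed

lemma continuous_besselK_kernel: "continuous_on A (besselK_kernel s z)"
  unfolding besselK_kernel_def[abs_def] by (intro continuous_intros)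

lemma measurable_besselK_kernel [measurable]: "besselK_kernel s z \<in> borel_measurable borel"
  by (rule borel_measurable_continuous_onI[OF continuous_besselK_kernel])

lemma integrable_besselK_kernel:
  assumes "Re z > 0"
  shows "integrable lborel (besselK_kernel s z)"
proof (rule Bochner_Integration.integrable_bound[OF integrable_exp_minus_cosh[OF assms, of "\<bar>Re s\<bar>"]])
  show "AE u in lborel. norm (besselK_kernel s z u) \<le> norm (exp (- Re z * cosh u + \<bar>Re s\<bar> * \<bar>u\<bar>))"
    using norm_besselK_kernel_le[of s z] by simp
qed simp

text \<open>Substitute \<open>- u\<close> for \<open>u\<close>; \<open>cosh\<close> is even. This
  later lets the orders \<open>s\<close> and \<open>- s - 1\<close> share the same
  integrals.\<close>

lemma besselK_integral_minus: "besselK_integral (- s) z = besselK_integral s z"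
  unfolding besselK_integral_def
  by (subst lborel_integral_real_affine[where c = "-1" and t = 0])
     (auto intro!: Bochner_Integration.integral_cong simp: besselK_kernel_def)

section \<open>Recurrence and derivatives of the integral through order shifts\<close>

lemma besselK_kernel_shift:
  "of_real (exp (- u)) * besselK_kernel s z u = besselK_kernel (s + 1) z u"
  "of_real (exp u) * besselK_kernel s z u = besselK_kernel (s - 1) z u"
  unfolding besselK_kernel_def exp_of_real[symmetric] mult_exp_exp
  by (rule arg_cong[of _ _ exp], simp add: ring_distribs)+

lemma besselK_kernel_cosh:
  "of_real (cosh u) * besselK_kernel s z u = (besselK_kernel (s - 1) z u + besselK_kernel (s + 1) z u) / 2"
  unfolding cosh_field_def of_real_divide of_real_add times_divide_eq_left distrib_right besselK_kernel_shift
  by simp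

lemma besselK_kernel_sinh:
  "of_real (sinh u) * besselK_kernel s z u = (besselK_kernel (s - 1) z u - besselK_kernel (s + 1) z u) / 2"
  unfolding sinh_field_def of_real_divide of_real_diff times_divide_eq_left left_diff_distrib besselK_kernel_shift
  by simp

lemma besselK_kernel_tendsto_0:
  assumes "Re z > 0"
  shows "(besselK_kernel s z \<longlongrightarrow> 0) at_top" "(besselK_kernel s z \<longlongrightarrow> 0) at_bot"
proof -
  define c where "c = exp ((\<bar>Re s\<bar> + 1)\<^sup>2 / Re z)"
  have bound: "norm (besselK_kernel s z u) \<le> c * exp (- 1 * \<bar>u\<bar>)" for u
    unfolding c_def by (rule order_trans[OF norm_besselK_kernel_le exp_minus_cosh_le[OF assms]])
  have "((\<lambda>u::real. c * exp (- norm u)) \<longlongrightarrow> c * 0) at_infinity"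
    by (intro tendsto_mult tendsto_const filterlim_compose[OF exp_at_bot]
          filterlim_compose[OF filterlim_uminus_at_bot_at_top filterlim_norm_at_top])
  hence "(besselK_kernel s z \<longlongrightarrow> 0) at_infinity"
    by (intro Lim_null_comparison[OF always_eventually[OF allI[OF bound]]]) simp
  thus "(besselK_kernel s z \<longlongrightarrow> 0) at_top" "(besselK_kernel s z \<longlongrightarrow> 0) at_bot"
    by (rule tendsto_mono[OF at_top_le_at_infinity], rule tendsto_mono[OF at_bot_le_at_infinity])
qed

text \<open>The \<open>u\<close>-derivative of the kernel integrates to 0, since the kernel vanishes
  at both ends. That derivative has the factor \<open>- z sinh u - s\<close>, and
  \<open>sinh u\<close> is half the difference of two order shifts.\<close>

lemma besselK_integral_rec:
  assumes "Re z > 0"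
  shows "besselK_integral (s + 1) z - besselK_integral (s - 1) z = 2 * s / z * besselK_integral s z"
proof -
  let ?k = "\<lambda>s. besselK_kernel s z"
  let ?f = "\<lambda>u. - (z / 2) * (?k (s - 1) u - ?k (s + 1) u) - s * ?k s u"
  note i = integrable_besselK_kernel[OF assms]
  have z0: "z \<noteq> 0" using assms by auto
  have der: "(?k s has_vector_derivative ?f u) (at u)" for u
  proof -
    have "((\<lambda>w. exp (- z * cosh w - s * w)) has_field_derivative
        exp (- z * cosh (of_real u) - s * of_real u) * (- z * sinh (of_real u) - s)) (at (of_real u))"
      by (auto intro!: derivative_eq_intros)
    from has_vector_derivative_real_field[OF this]
    have "(?k s has_vector_derivative ?k s u * (- z * of_real (sinh u) - s)) (at u)"
      by (simp add: besselK_kernel_def[abs_def] cosh_field_def sinh_field_def exp_of_real flip: of_real_minus)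
    also have "?k s u * (- z * of_real (sinh u) - s) = ?f u"
    proof -
      have "?k s u * (- z * of_real (sinh u) - s) = - z * (of_real (sinh u) * ?k s u) - s * ?k s u"
        by (simp add: algebra_simps)
      thus ?thesis unfolding besselK_kernel_sinh by simp
    qed
    finally show ?thesis .
  qed
  have intf: "integrable lborel ?f"
    by (intro Bochner_Integration.integrable_diff integrable_mult_right i)
  have "(LBINT u=-\<infinity>..\<infinity>. ?f u) = 0 - 0"
  proof (rule interval_integral_FTC_integrable[where F = "?k s"])
    show "isCont ?f u" for u
      using continuous_besselK_kernel[of UNIV _ z]
      by (intro continuous_intros) (auto simp: continuous_on_eq_continuous_at)
    show "set_integrable lborel (einterval (-\<infinity>) \<infinity>) ?f"
      using intf by (simp add: set_integrable_def einterval_def)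
    show "((?k s \<circ> real_of_ereal) \<longlongrightarrow> 0) (at_right (-\<infinity>))" "((?k s \<circ> real_of_ereal) \<longlongrightarrow> 0) (at_left \<infinity>)"
      by (simp_all add: ereal_tendsto_simps besselK_kernel_tendsto_0[OF assms])
  qed (use der in auto)
  hence "(LBINT u. ?f u) = 0"
    by (simp add: interval_lebesgue_integral_def set_lebesgue_integral_def einterval_def)
  hence "- (z / 2) * ((LBINT u. ?k (s - 1) u) - (LBINT u. ?k (s + 1) u)) - s * (LBINT u. ?k s u) = 0"
    by (simp add: i)
  thus ?thesis
    using z0 by (simp add: besselK_integral_def field_simps)
qed

text \<open>The error of the difference quotient is estimated directly: the integrand is a
  first-order Taylor remainder, quadratic in \<open>h\<close> with an integrable
  coefficient.\<close>

lemma DERIV_besselK_integral_aux: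
  assumes "Re z > 0"
  shows "(besselK_integral s has_field_derivative
           - (besselK_integral (s - 1) z + besselK_integral (s + 1) z) / 2) (at z)"
proof -
  define D where "D = - (besselK_integral (s - 1) z + besselK_integral (s + 1) z) / 2"
  \<comment> \<open>Half of the decay rate \<open>Re z\<close> is given up to absorb
    \<open>exp (norm h * cosh u)\<close> for \<open>norm h < a\<close>; the extra 2 in
    \<open>m\<close> absorbs \<open>(cosh u)^2 <= exp (2 \<bar>u\<bar>)\<close>.\<close>
  define a m where "a = Re z / 2" and "m = \<bar>Re s\<bar> + 2"
  define M where "M = (LBINT u. exp (- a * cosh u + m * \<bar>u\<bar>)) / 2"
  note i = integrable_besselK_kernel
  have a: "a > 0" using assms by (simp add: a_def)
  note iM = integrable_exp_minus_cosh[OF a, of m]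
  have bound: "norm ((besselK_integral s (z + h) - besselK_integral s z) / h - D) \<le> M * norm h"
    if h: "h \<noteq> 0" "norm h < a" for h
  proof -
    have zh: "Re (z + h) > 0" using h abs_Re_le_cmod[of h] by (simp add: a_def)
    have "besselK_integral s (z + h) - besselK_integral s z - h * D =
        (LBINT u. besselK_kernel s (z + h) u - besselK_kernel s z u +
            h * ((besselK_kernel (s - 1) z u + besselK_kernel (s + 1) z u) / 2)) / 2"
      by (simp add: besselK_integral_def D_def i[OF zh] i[OF assms]) (simp add: field_simps)
    also have "norm \<dots> \<le> (LBINT u. (norm h)\<^sup>2 * exp (- a * cosh u + m * \<bar>u\<bar>)) / 2"
      unfolding norm_divide norm_numeral
    proof (intro divide_right_mono Bochner_Integration.integral_norm_bound_integral)
      fix u :: real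
      let ?c = "complex_of_real (cosh u)"
      \<comment> \<open>The mean of the two shifted kernels is \<open>cosh u\<close> times the
        kernel, so the bracket is \<open>exp\<close> at \<open>- h cosh u\<close> minus its linear
        Taylor polynomial.\<close>
      have "besselK_kernel s (z + h) u - besselK_kernel s z u +
          h * ((besselK_kernel (s - 1) z u + besselK_kernel (s + 1) z u) / 2) =
          besselK_kernel s z u * (exp (- h * ?c) - (\<Sum>k\<le>1. (- h * ?c) ^ k / fact k))"
        unfolding besselK_kernel_cosh[symmetric]
        by (simp add: besselK_kernel_def algebra_simps flip: exp_add)
      also have "norm \<dots> \<le> exp (- Re z * cosh u + \<bar>Re s\<bar> * \<bar>u\<bar>) * 
           (exp (norm (- h * ?c)) * norm (- h * ?c) ^ Suc 1 / fact 1)"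
        unfolding norm_mult[of "besselK_kernel s z u"]
        by (intro mult_mono norm_besselK_kernel_le Taylor_exp_field) auto
      also have "\<dots> = (norm h)\<^sup>2 * (exp (- Re z * cosh u + \<bar>Re s\<bar> * \<bar>u\<bar>) * exp (norm h * cosh u) * (cosh u)\<^sup>2)"
        by (simp add: norm_mult power2_eq_square)
      also have "\<dots> \<le> (norm h)\<^sup>2 * (exp (- Re z * cosh u + \<bar>Re s\<bar> * \<bar>u\<bar>) * exp (a * cosh u) * (exp \<bar>u\<bar>)\<^sup>2)"
        using h by (intro mult_left_mono mult_mono power_mono cosh_le_exp_abs) auto
      also have "\<dots> = (norm h)\<^sup>2 * exp (- a * cosh u + m * \<bar>u\<bar>)"
        by (simp add: a_def m_def power2_eq_square algebra_simps flip: exp_add)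
      finally show "norm (besselK_kernel s (z + h) u - besselK_kernel s z u +
          h * ((besselK_kernel (s - 1) z u + besselK_kernel (s + 1) z u) / 2)) \<le> \<dots>" .
    next
      show "integrable lborel (\<lambda>u. besselK_kernel s (z + h) u - besselK_kernel s z u +
          h * ((besselK_kernel (s - 1) z u + besselK_kernel (s + 1) z u) / 2))"
        by (intro Bochner_Integration.integrable_add Bochner_Integration.integrable_diff
            integrable_mult_right integrable_divide i assms zh)
      show "integrable lborel (\<lambda>u. (norm h)\<^sup>2 * exp (- a * cosh u + m * \<bar>u\<bar>))"
        by (intro integrable_mult_right iM)
    qed simp
    also have "\<dots> = M * norm h * norm h"
      by (simp add: M_def power2_eq_square)
    finally have "norm (besselK_integral s (z + h) - besselK_integral s z - h * D) \<le> M * norm h * norm h" .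
    hence "norm (besselK_integral s (z + h) - besselK_integral s z - h * D) / norm h \<le> M * norm h"
      using h by (simp add: divide_le_eq)
    also have "norm (besselK_integral s (z + h) - besselK_integral s z - h * D) / norm h =
        norm ((besselK_integral s (z + h) - besselK_integral s z) / h - D)"
      using h by (simp add: diff_divide_distrib flip: norm_divide)
    finally show ?thesis .
  qed
  have "((\<lambda>h. M * norm h) \<longlongrightarrow> M * norm (0 :: complex)) (at (0 :: complex))"
    by (intro tendsto_mult tendsto_const tendsto_norm tendsto_ident_at)
  hence "((\<lambda>h. M * norm h) \<longlongrightarrow> 0) (at (0 :: complex))" by simp
  hence "((\<lambda>h. (besselK_integral s (z + h) - besselK_integral s z) / h - D) \<longlongrightarrow> 0) (at 0)"
    by (rule Lim_null_comparison[rotated])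
       (use bound a in \<open>auto simp: eventually_at dist_norm intro!: exI[of _ a]\<close>)
  thus ?thesis
    unfolding DERIV_def D_def[symmetric] by (subst (asm) LIM_zero_iff)
qed

text \<open>The recurrence eliminates order \<open>s - 1\<close>. The raised order enters with the
  sign opposite to that in \<open>DERIV_besselI\<close>, so the two products in
  \<open>besselIK\<close> are added.\<close>

lemma DERIV_besselK_integral:
  assumes "Re z > 0"
  shows "(besselK_integral s has_field_derivative
           - besselK_integral (s + 1) z + s / z * besselK_integral s z) (at z)"
proof (rule DERIV_cong[OF DERIV_besselK_integral_aux[OF assms]])
  define X where "X = s / z * besselK_integral s z"
  have "besselK_integral (s + 1) z - besselK_integral (s - 1) z = 2 * X"
    unfolding besselK_integral_rec[OF assms] X_def by simp
  hence "besselK_integral (s - 1) z = besselK_integral (s + 1) z - 2 * X"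
    by (simp add: diff_eq_eq add.commute)
  thus "- (besselK_integral (s - 1) z + besselK_integral (s + 1) z) / 2 =
      - besselK_integral (s + 1) z + s / z * besselK_integral s z"
    unfolding X_def[symmetric] by simp
qed

lemma DERIV_besselK_integral':
  assumes "Re z > 0"
  shows "(besselK_integral (s + 1) has_field_derivative
           - besselK_integral s z - (s + 1) / z * besselK_integral (s + 1) z) (at z)"
proof -
  define X where "X = (s + 1) / z * besselK_integral (s + 1) z"
  have "besselK_integral (s + 1 + 1) z - besselK_integral s z = 2 * X"
    using besselK_integral_rec[OF assms, of "s + 1"] unfolding X_def by simp
  hence "besselK_integral (s + 1 + 1) z = besselK_integral s z + 2 * X"
    by (simp add: diff_eq_eq add.commute)
  thus ?thesis
    using DERIV_besselK_integral[OF assms, of "s + 1"] unfolding X_def[symmetric]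
    by (simp add: minus_diff_commute)
qed

section \<open>Continuity in the order and decay along rays\<close>

lemma isCont_besselK_integral_order:
  assumes "Re z > 0"
  shows "isCont (\<lambda>s. besselK_integral s z) s"
  unfolding continuous_at_sequentially
proof safe
  fix X :: "nat \<Rightarrow> complex" assume X: "X \<longlonglongrightarrow> s"
  hence "Bseq X" by (rule convergent_imp_Bseq[OF convergentI])
  \<comment> \<open>A bound on the whole convergent sequence of orders provides one majorant for
    dominated convergence.\<close>
  then obtain m where m: "\<And>n. norm (X n) \<le> m" unfolding Bseq_def by blast
  have "(\<lambda>n. LBINT u. besselK_kernel (X n) z u) \<longlonglongrightarrow> (LBINT u. besselK_kernel s z u)"
  proof (rule integral_dominated_convergence)
    show "integrable lborel (\<lambda>u. exp (- Re z * cosh u + m * \<bar>u\<bar>))"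
      by (rule integrable_exp_minus_cosh[OF assms])
    show "AE u in lborel. (\<lambda>n. besselK_kernel (X n) z u) \<longlonglongrightarrow> besselK_kernel s z u"
      unfolding besselK_kernel_def by (intro AE_I2 tendsto_intros X)
    show "AE u in lborel. norm (besselK_kernel (X n) z u) \<le> exp (- Re z * cosh u + m * \<bar>u\<bar>)" for n
    proof (intro AE_I2)
      fix u
      have "\<bar>Re (X n)\<bar> * \<bar>u\<bar> \<le> m * \<bar>u\<bar>"
        using m[of n] abs_Re_le_cmod[of "X n"] by (intro mult_right_mono) auto
      thus "norm (besselK_kernel (X n) z u) \<le> exp (- Re z * cosh u + m * \<bar>u\<bar>)"
        using norm_besselK_kernel_le[of "X n" z u] by (elim order_trans) simp
    qed
  qed simp_all
  thus "((\<lambda>s. besselK_integral s z) \<circ> X) \<longlonglongrightarrow> besselK_integral s z"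
    unfolding besselK_integral_def o_def by (intro tendsto_divide tendsto_const) auto
qed

text \<open>For \<open>r >= 1\<close> the inequality \<open>(r - 1) (cosh u - 1) >= 0\<close> gives
  \<open>r cosh u >= (r - 1) + cosh u\<close>: the factor \<open>exp (- Re p (r - 1))\<close> comes
  out of the integral, leaving the majorant at \<open>r = 1\<close>.\<close>

lemma besselK_integral_decay:
  assumes "Re p > 0"
  obtains C where "C \<ge> 0" "\<And>r. r \<ge> 1 \<Longrightarrow> norm (besselK_integral s (p * of_real r)) \<le> C * exp (- Re p * r)"
proof
  define J where "J = (LBINT u. exp (- Re p * cosh u + \<bar>Re s\<bar> * \<bar>u\<bar>))"
  define C where "C = exp (Re p) * J / 2"
  show "C \<ge> 0" unfolding C_def J_def by (intro mult_nonneg_nonneg divide_nonneg_nonneg integral_nonneg) auto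
  fix r :: real assume r: "r \<ge> 1"
  have "norm (LBINT u. besselK_kernel s (p * of_real r) u) \<le>
      (LBINT u. exp (Re p) * exp (- Re p * r) * exp (- Re p * cosh u + \<bar>Re s\<bar> * \<bar>u\<bar>))"
  proof (rule Bochner_Integration.integral_norm_bound_integral)
    show "integrable lborel (besselK_kernel s (p * of_real r))"
      using assms r by (intro integrable_besselK_kernel) simp
    show "integrable lborel (\<lambda>u. exp (Re p) * exp (- Re p * r) * exp (- Re p * cosh u + \<bar>Re s\<bar> * \<bar>u\<bar>))"
      by (intro integrable_mult_right integrable_exp_minus_cosh assms)
    fix u :: real
    have "0 \<le> Re p * ((r - 1) * (cosh u - 1))"
      using r assms cosh_real_ge_1[of u] by (intro mult_nonneg_nonneg) auto
    hence "exp (- Re (p * of_real r) * cosh u + \<bar>Re s\<bar> * \<bar>u\<bar>) \<le>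
        exp (Re p) * exp (- Re p * r) * exp (- Re p * cosh u + \<bar>Re s\<bar> * \<bar>u\<bar>)"
      by (simp add: algebra_simps flip: exp_add)
    with norm_besselK_kernel_le[of s "p * of_real r" u]
    show "norm (besselK_kernel s (p * of_real r) u) \<le>
        exp (Re p) * exp (- Re p * r) * exp (- Re p * cosh u + \<bar>Re s\<bar> * \<bar>u\<bar>)"
      by (rule order_trans)
  qed
  also have "\<dots> = 2 * (C * exp (- Re p * r))"
    by (simp add: C_def J_def)
  finally show "norm (besselK_integral s (p * of_real r)) \<le> C * exp (- Re p * r)"
    by (simp add: besselK_integral_def norm_divide)
qed

section \<open>Identification of \<open>K\<close> with the integral\<close>

lemma Gamma_integral_exp:
  assumes "Re a > 0"
  shows "integrable lborel (\<lambda>v. exp (a * of_real v - of_real (exp v)))" (is "integrable _ ?g")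
    and "(LBINT v. exp (a * of_real v - of_real (exp v))) = Gamma a"
proof -
  define c where "c = Re a"
  have c: "c > 0" using assms by (simp add: c_def)
  show int: "integrable lborel ?g"
  proof (rule Bochner_Integration.integrable_bound)
    show "integrable lborel (\<lambda>v :: real. exp (2 * c\<^sup>2) * exp (- c * \<bar>v\<bar>))"
      by (intro integrable_mult_right integrable_exp_minus_abs c)
    show "AE v in lborel. norm (?g v) \<le> norm (exp (2 * c\<^sup>2) * exp (- c * \<bar>v\<bar>))"
    proof (intro AE_I2)
      fix v :: real
      \<comment> \<open>For \<open>v >= 0\<close> this is \<open>exp v >= v^2 / 2\<close> together
        with \<open>(v - 2 c)^2 >= 0\<close>, whence the constant \<open>2 c^2\<close>; for
        \<open>v < 0\<close> the term \<open>c v\<close> is itself the decay.\<close>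
      have "c * v - exp v \<le> 2 * c\<^sup>2 - c * \<bar>v\<bar>"
      proof (cases "v \<ge> 0")
        case True
        have "0 \<le> (v - 2 * c)\<^sup>2 / 2" by simp
        also have "\<dots> = v\<^sup>2 / 2 - 2 * c * v + 2 * c\<^sup>2"
          by (simp add: power2_eq_square field_simps)
        also have "v\<^sup>2 / 2 \<le> exp v"
          using exp_lower_Taylor_quadratic[OF True] True by simp
        finally show ?thesis using True by simp
      next
        case False
        have "- exp v \<le> 2 * c\<^sup>2"
          by (rule order_trans[of _ 0]) auto
        thus ?thesis using False by simp
      qed
      thus "norm (?g v) \<le> norm (exp (2 * c\<^sup>2) * exp (- c * \<bar>v\<bar>))"
        by (simp add: c_def flip: exp_add)
    qed
  qed (auto intro!: borel_measurable_continuous_onI continuous_intros)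
  \<comment> \<open>Euler's integrand; under \<open>t = exp v\<close> the Jacobian raises the
    exponent \<open>a - 1\<close> to \<open>a\<close>.\<close>
  define f where "f = (\<lambda>t. of_real t powr (a - 1) / of_real (exp t) :: complex)"
  have fg: "exp v *\<^sub>R f (exp v) = ?g v" for v
  proof -
    have "of_real (exp v) powr (a - 1) = exp ((a - 1) * of_real v)"
      by (simp add: powr_def flip: exp_of_real)
    thus ?thesis
      by (simp add: f_def scaleR_conv_of_real exp_diff ring_distribs flip: exp_of_real)
  qed
  have f_abs: "f absolutely_integrable_on {0<..}"
    unfolding f_def by (rule absolutely_integrable_Gamma_integral'[OF assms])
  have f_meas: "(\<lambda>t. indicator {0<..} t *\<^sub>R f t) \<in> borel_measurable borel"
    by (rule borel_measurable_continuous_on_indicator) (auto simp: f_def intro!: continuous_intros)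
  have f_int: "set_integrable lborel {0<..} f"
    using f_abs f_meas unfolding set_integrable_def by (subst (asm) integrable_completion) auto
  have ei: "einterval 0 \<infinity> = {0<..}" "einterval (- \<infinity>) \<infinity> = UNIV"
    by (auto simp: einterval_def zero_ereal_def)
  have "(LBINT t=0..\<infinity>. f t) = (LBINT v=-\<infinity>..\<infinity>. exp v *\<^sub>R f (exp v))"
  proof (rule interval_integral_substitution_integrable)
    show "((ereal \<circ> exp \<circ> real_of_ereal) \<longlongrightarrow> 0) (at_right (- \<infinity>))"
      by (auto simp: ereal_tendsto_simps zero_ereal_def exp_at_bot)
    show "((ereal \<circ> exp \<circ> real_of_ereal) \<longlongrightarrow> \<infinity>) (at_left \<infinity>)"
      by (auto simp: ereal_tendsto_simps exp_at_top)
    show "set_integrable lborel (einterval (- \<infinity>) \<infinity>) (\<lambda>v. exp v *\<^sub>R f (exp v))"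
      unfolding fg ei using int by (simp add: set_integrable_def)
    show "set_integrable lborel (einterval 0 \<infinity>) f"
      unfolding ei by (rule f_int)
    show "isCont f (exp v)" for v
      by (auto simp: f_def intro!: continuous_intros)
  qed (auto intro!: derivative_eq_intros)
  moreover have "(LBINT t=0..\<infinity>. f t) = (LBINT t:{0<..}. f t)"
    by (simp add: interval_lebesgue_integral_def ei)
  moreover have "(LBINT v=-\<infinity>..\<infinity>. ?g v) = (LBINT v. ?g v)"
    by (simp add: interval_lebesgue_integral_def set_lebesgue_integral_def ei)
  ultimately have "(LBINT v. ?g v) = (LBINT t:{0<..}. f t)"
    unfolding fg by (simp only:)
  also have "\<dots> = integral {0<..} f"
    by (rule set_borel_integral_eq_integral[OF f_int])
  also have "\<dots> = Gamma a"
    using Gamma_integral_complex'[OF assms] by (simp add: f_def integral_unique)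
  finally show "(LBINT v. ?g v) = Gamma a" .
qed

text \<open>The substitution \<open>u = ln (x / 2) - v\<close> absorbs the power of
  \<open>x / 2\<close> and turns \<open>x cosh u\<close> into
  \<open>exp v + x^2 / 4 exp (- v)\<close>. As \<open>x\<close> tends to 0, Euler's integral in the
  variable \<open>v\<close> remains.\<close>

lemma besselK_integral_at_0:
  assumes "Re a > 0"
  shows "((\<lambda>x :: real. (of_real x / 2) powr a * besselK_integral a (of_real x)) \<longlongrightarrow> Gamma a / 2) (at_right 0)"
proof -
  define g where "g = (\<lambda>x v. exp (a * of_real v - of_real (exp v) - of_real (x\<^sup>2 / 4 * exp (- v))) :: complex)"
  have eq: "(of_real x / 2) powr a * besselK_integral a (of_real x) = (LBINT v. g x v) / 2"
    if x: "x > 0" for x :: real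
  proof -
    have "(LBINT u. besselK_kernel a (of_real x) u) = (LBINT v. besselK_kernel a (of_real x) (ln (x / 2) - v))"
      by (subst lborel_integral_real_affine[where c = "-1" and t = "ln (x / 2)"]) simp_all
    moreover have "(of_real x / 2) powr a * besselK_kernel a (of_real x) (ln (x / 2) - v) = g x v" for v
    proof -
      have "exp (ln (x / 2) - v) = x / 2 * exp (- v)" "exp (- (ln (x / 2) - v)) = 2 / x * exp v"
        using x by (simp_all add: exp_diff exp_minus exp_ln field_simps)
      hence 1: "x * cosh (ln (x / 2) - v) = x\<^sup>2 / 4 * exp (- v) + exp v"
        unfolding cosh_field_def using x by (simp add: field_simps power2_eq_square)
      have "of_real x * complex_of_real (cosh (ln (x / 2) - v)) = of_real (x\<^sup>2 / 4 * exp (- v) + exp v)"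
        unfolding 1[symmetric] by simp
      moreover have "(of_real x / 2 :: complex) powr a = exp (a * of_real (ln (x / 2)))"
        using x Ln_of_real[of "x / 2"] by (simp add: powr_def)
      ultimately show ?thesis
        unfolding besselK_kernel_def g_def mult_minus_left
        by (simp add: algebra_simps flip: exp_add)
    qed
    ultimately show ?thesis
      unfolding besselK_integral_def times_divide_eq_right by (simp flip: integral_mult_right_zero)
  qed
  have lim: "((\<lambda>x. (LBINT v. g x v) / 2) \<longlongrightarrow> Gamma a / 2) (at_right 0)"
    unfolding tendsto_at_iff_sequentially
  proof safe
    fix X :: "nat \<Rightarrow> real" assume X: "X \<longlonglongrightarrow> 0"
    have "(\<lambda>n. LBINT v. g (X n) v) \<longlonglongrightarrow> (LBINT v. g 0 v)"
    proof (rule integral_dominated_convergence)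
      \<comment> \<open>The factor \<open>exp (- x^2 / 4 exp (- v))\<close> is at most 1, so the
        limit integrand serves as majorant.\<close>
      show "integrable lborel (\<lambda>v. norm (exp (a * of_real v - of_real (exp v))))"
        by (intro integrable_norm Gamma_integral_exp assms)
      show "AE v in lborel. (\<lambda>n. g (X n) v) \<longlonglongrightarrow> g 0 v"
        unfolding g_def by (intro AE_I2 tendsto_intros X) auto
      show "AE v in lborel. norm (g (X n) v) \<le> norm (exp (a * of_real v - of_real (exp v)))" for n
        by (auto simp: g_def)
    qed (auto simp: g_def intro!: borel_measurable_continuous_onI continuous_intros)
    also have "(LBINT v. g 0 v) = Gamma a"
      by (simp add: g_def Gamma_integral_exp[OF assms])
    finally show "((\<lambda>x. (LBINT v. g x v) / 2) \<circ> X) \<longlonglongrightarrow> Gamma a / 2"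
      unfolding o_def by (intro tendsto_divide tendsto_const) auto
  qed
  show ?thesis
    by (rule Lim_transform_eventually[OF lim])
       (use eventually_at_right_less[of 0] in \<open>eventually_elim, simp add: eq\<close>)
qed

text \<open>The Wronskian of \<open>I\<^sub>s\<close> and the integral, with the derivatives eliminated by the first-order
  relations.\<close>

definition besselIK :: "complex \<Rightarrow> complex \<Rightarrow> complex" where
  "besselIK s z = z * (besselI s z * besselK_integral (s + 1) z + besselI (s + 1) z * besselK_integral s z)"

lemma DERIV_besselIK:
  assumes "Re z > 0"
  shows "(besselIK s has_field_derivative 0) (at z)"
proof -
  have z0: "z \<noteq> 0" using assms by auto
  note d = DERIV_besselI[OF assms, of s] DERIV_besselI'[OF assms, of s]
    DERIV_besselK_integral[OF assms, of s] DERIV_besselK_integral'[OF assms, of s]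
  show ?thesis
    unfolding besselIK_def[abs_def]
    by (rule derivative_eq_intros d refl)+ (use z0 in \<open>simp add: field_simps\<close>)
qed

text \<open>With the same coefficient \<open>X\<close> in both recurrences, either side contains the
  cross term \<open>X\<close> times the two functions of order \<open>s + 1\<close>, and the other
  terms match.\<close>

lemma besselIK_Suc:
  assumes "Re z > 0"
  shows "besselIK s z = besselIK (s + 1) z"
proof -
  have z0: "z \<noteq> 0" using assms by auto
  define X where "X = 2 * (s + 1) / z"
  have "besselI s z = besselI (s + 1 + 1) z + X * besselI (s + 1) z"
    using besselI_rec[OF z0, of "s + 1"] by (simp add: X_def diff_eq_eq add.commute)
  moreover have "besselK_integral (s + 1 + 1) z = besselK_integral s z + X * besselK_integral (s + 1) z"
    using besselK_integral_rec[OF assms, of "s + 1"] by (simp add: X_def diff_eq_eq add.commute)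
  ultimately show ?thesis
    unfolding besselIK_def by (simp only: ring_distribs mult_ac add_ac)
qed

lemma besselIK_eq_1:
  assumes "Re z > 0"
  shows "besselIK s z = 1"
proof -
  \<comment> \<open>Here \<open>Re s > 0\<close> makes the limit at 0 available for both orders
    \<open>s\<close> and \<open>s + 1\<close>.\<close>
  have pos: "besselIK s z = 1" if s: "Re s > 0" for s
  proof (rule half_plane_DERIV_zero_const[OF DERIV_besselIK _ assms])
    define k where "k = (\<lambda>a x. (of_real x / 2) powr a * besselK_integral a (of_real x :: complex))"
    \<comment> \<open>The powers are regrouped so that each integral carries the power of its own
      order; \<open>k a x\<close> then tends to \<open>Gamma a / 2\<close>.\<close>
    have eq: "besselIK s (of_real x) = 2 * bessel_series s (of_real (x\<^sup>2 / 4)) * k (s + 1) x +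
        of_real (x\<^sup>2 / 2) * bessel_series (s + 1) (of_real (x\<^sup>2 / 4)) * k s x" if "x > 0" for x :: real
    proof -
      have *: "(of_real x / 2 :: complex) powr (s + 1) = (of_real x / 2) powr s * (of_real x / 2)"
        using that by (simp add: powr_add)
      have "X * (P * b * k + P * (X / 2) * b' * k') = 2 * b * (P * (X / 2) * k) + X\<^sup>2 / 2 * b' * (P * k')"
        for X P b b' k k' :: complex
        by (simp add: power2_eq_square algebra_simps)
      thus ?thesis
        unfolding besselIK_def besselI_eq k_def * of_real_divide of_real_power of_real_numeral .
    qed
    have "((\<lambda>x::real. 2 * bessel_series s (of_real (x\<^sup>2 / 4)) * k (s + 1) x +
        of_real (x\<^sup>2 / 2) * bessel_series (s + 1) (of_real (x\<^sup>2 / 4)) * k s x) \<longlongrightarrow>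
        2 * bessel_series s (of_real (0\<^sup>2 / 4)) * (Gamma (s + 1) / 2) +
        of_real (0\<^sup>2 / 2) * bessel_series (s + 1) (of_real (0\<^sup>2 / 4)) * (Gamma s / 2)) (at_right 0)"
      unfolding k_def using s
      by (intro tendsto_add tendsto_mult tendsto_const besselK_integral_at_0
          isCont_tendsto_compose[OF isCont_bessel_series] tendsto_of_real tendsto_divide tendsto_power
          tendsto_ident_at) simp_all
    also have "2 * bessel_series s (of_real (0\<^sup>2 / 4)) * (Gamma (s + 1) / 2) +
        of_real (0\<^sup>2 / 2) * bessel_series (s + 1) (of_real (0\<^sup>2 / 4)) * (Gamma s / 2) = rGamma (s + 1) * Gamma (s + 1)"
      by (simp add: bessel_series_0)
    also have "\<dots> = 1"
    proof -
      have "Gamma (s + 1) \<noteq> 0"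
        using s by (auto simp: Gamma_eq_zero_iff elim!: nonpos_Ints_cases dest: arg_cong[of _ _ Re])
      thus ?thesis by (simp add: rGamma_inverse_Gamma)
    qed
    finally show "((\<lambda>x. besselIK s (of_real x)) \<longlongrightarrow> 1) (at_right 0)"
      by (rule Lim_transform_eventually)
         (use eventually_at_right_less[of 0] in \<open>eventually_elim, simp add: eq\<close>)
  qed
  \<comment> \<open>Raising the order repeatedly moves any \<open>s\<close> into the half-plane
    already treated.\<close>
  have "besselIK s z = besselIK (s + of_nat n) z" for n
  proof (induction n)
    case (Suc n)
    also note besselIK_Suc[OF assms]
    finally show ?case by (simp add: add_ac)
  qed simp
  moreover obtain n where "real n > - Re s"
    using reals_Archimedean2 by blast
  ultimately show ?thesis
    using pos[of "s + of_nat n"] by simp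
qed

lemma besselI_diff_eq:
  assumes "Re z > 0"
  shows "besselI (- s) z - besselI s z = 2 * sin (of_real pi * s) / of_real pi * besselK_integral s z"
proof -
  \<comment> \<open>The factors equal to 1 are chosen so that the integrals of order
    \<open>s + 1\<close> cancel.\<close>
  have "besselI (- s) z - besselI s z = besselI (- s) z * besselIK s z - besselI s z * besselIK (- s - 1) z"
    by (simp add: besselIK_eq_1[OF assms])
  also have "besselIK (- s - 1) z = z * (besselI (- s - 1) z * besselK_integral s z + besselI (- s) z * besselK_integral (s + 1) z)"
    using besselK_integral_minus[of "s + 1" z] by (simp add: besselIK_def besselK_integral_minus)
  also have "besselI (- s) z * besselIK s z - besselI s z * \<dots> =
      z * (besselI (s + 1) z * besselI (- s) z - besselI (- s - 1) z * besselI s z) * besselK_integral s z"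
    by (simp add: besselIK_def algebra_simps)
  finally show ?thesis
    unfolding besselI_Wronskian[OF assms] .
qed

lemma besselK_eq_integral:
  assumes "Re z > 0"
  shows "besselK s z = besselK_integral s z"
proof -
  define Q where "Q = (\<lambda>s. of_real pi / 2 * (besselI (- s) z - besselI s z) / sin (s * of_real pi))"
  have sin0: "sin (w * of_real pi) \<noteq> 0" if "w \<notin> \<int>" for w :: complex
    using that by (auto simp: sin_eq_0)
  have Q: "Q w = besselK_integral w z" if "w \<notin> \<int>" for w
    using sin0[OF that] by (simp add: Q_def besselI_diff_eq[OF assms] mult.commute)
  show ?thesis
  proof (cases "s \<in> \<int>")
    case False
    thus ?thesis using Q[OF False] by (simp add: besselK_def Q_def)
  next
    case True
    \<comment> \<open>Distinct integers are at least 1 apart, so a punctured neighbourhood of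
      \<open>s\<close> contains only orders where the quotient formula applies.\<close>
    have "eventually (\<lambda>w. w \<notin> \<int>) (at s)"
    proof -
      have "w \<notin> \<int>" if w: "w \<noteq> s" "dist w s < 1" for w
      proof
        assume "w \<in> \<int>"
        hence "w - s \<in> \<int>" using True by (rule Ints_diff)
        then obtain k where k: "w - s = of_int k" by (rule Ints_cases)
        with w(2) have "\<bar>k\<bar> < 1" by (simp add: dist_norm)
        with k w(1) show False by simp
      qed
      thus ?thesis unfolding eventually_at by (intro exI[of _ 1]) auto
    qed
    hence "eventually (\<lambda>w. besselK_integral w z = Q w) (at s)"
      by eventually_elim (simp add: Q)
    hence "(Q \<longlongrightarrow> besselK_integral s z) (at s)"
      using isCont_besselK_integral_order[OF assms, of s] unfolding isCont_def
      by (rule Lim_transform_eventually[rotated])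
    hence "Lim (at s) Q = besselK_integral s z"
      by (intro tendsto_Lim) auto
    thus ?thesis using True by (simp add: besselK_def Q_def)
  qed
qed

section \<open>Termwise integration\<close>

text \<open>A single term of the exponential series of \<open>c / t\<close> already outweighs a
  negative power of \<open>t\<close>.\<close>

lemma powr_exp_inverse_bounded:
  fixes b c :: real
  assumes "c > 0"
  obtains M where "M \<ge> 0" "\<And>t. 0 < t \<Longrightarrow> t < 1 \<Longrightarrow> t powr b * exp (- c / t) \<le> M"
proof
  \<comment> \<open>Rounding \<open>- b\<close> up gives \<open>t powr b <= t powr (- N)\<close> on
    (0,1); for \<open>b >= 0\<close> the truncation yields \<open>N = 0\<close>.\<close>
  define N where "N = nat \<lceil>- b\<rceil>"
  show "fact N / c ^ N \<ge> 0" using assms by simp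
  fix t :: real assume t: "0 < t" "t < 1"
  have "(\<Sum>k\<in>{N}. (c / t) ^ k / fact k) \<le> (\<Sum>k. (c / t) ^ k / fact k)"
    using assms t summable_exp[of "c / t"]
    by (intro sum_le_suminf) (auto simp: field_simps)
  hence exp_ge: "(c / t) ^ N / fact N \<le> exp (c / t)"
    by (simp add: exp_def field_simps)
  have "t powr b \<le> t powr (- real N)"
    using t by (intro powr_mono') (auto simp: N_def, linarith)
  also have "\<dots> = 1 / t ^ N"
    using t by (simp add: powr_minus powr_realpow inverse_eq_divide)
  finally have "t powr b * c ^ N / fact N \<le> 1 / t ^ N * c ^ N / fact N"
    using assms by (intro divide_right_mono mult_right_mono) auto
  also have "\<dots> = (c / t) ^ N / fact N" by (simp add: power_divide)
  also note exp_ge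
  finally have "t powr b * c ^ N / fact N * exp (- (c / t)) \<le> exp (c / t) * exp (- (c / t))"
    by (rule mult_right_mono) simp
  also have "\<dots> = 1" by (simp flip: exp_add)
  finally show "t powr b * exp (- c / t) \<le> fact N / c ^ N"
    using assms by (simp add: field_simps)
qed

section \<open>The binomial series and its termwise majorant\<close>

lemma norm_pochhammer_le:
  "norm (pochhammer y n) \<le> pochhammer (norm (y :: complex)) n"
proof (induction n)
  case (Suc n)
  have "norm (y + of_nat n) \<le> norm y + real n"
    using norm_triangle_ineq[of y "of_nat n"] by simp
  with Suc show ?case
    by (simp add: pochhammer_rec' norm_mult mult_mono)
qed simp

lemma gbinomial_minus_mult_power:
  fixes t y :: "'a :: field_char_0"
  shows "((- y) gchoose n) * (- t) ^ n = pochhammer y n / fact n * t ^ n"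
proof -
  have "((- y) gchoose n) * (- t) ^ n = ((- 1) ^ n * (- 1) ^ n) * (pochhammer y n / fact n * t ^ n)"
    unfolding gbinomial_pochhammer power_minus[of t] minus_minus
    by (simp only: mult_ac times_divide_eq_right times_divide_eq_left)
  thus ?thesis by (simp only: minus_one_mult_self mult_1_left)
qed

lemma pochhammer_powser_sums:
  fixes y :: complex
  assumes "0 < t" "t < 1"
  shows "(\<lambda>n. pochhammer y n / fact n * of_real t ^ n) sums (of_real (1 - t) powr (- y))"
proof -
  have "(\<lambda>n. ((- y) gchoose n) * (- of_real t) ^ n) sums (1 + (- of_real t)) powr (- y)"
    using assms by (intro gen_binomial_complex) simp
  thus ?thesis unfolding gbinomial_minus_mult_power by simp
qed

lemma pochhammer_powser_sums_real:
  fixes y :: real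
  assumes "0 < t" "t < 1"
  shows "(\<lambda>n. pochhammer y n / fact n * t ^ n) sums ((1 - t) powr (- y))"
proof -
  have "(\<lambda>n. ((- y) gchoose n) * (- t) ^ n) sums (1 + (- t)) powr (- y)"
    using assms by (intro gen_binomial_real) simp
  thus ?thesis unfolding gbinomial_minus_mult_power by simp
qed

text \<open>A uniform bound on the sums of norms makes the constant \<open>B\<close> a majorant for
  all partial sums, and a constant is integrable on the unit interval; dominated convergence
  applies.\<close>

lemma sums_LBINT_unit_interval_bounded:
  fixes f :: "nat \<Rightarrow> real \<Rightarrow> complex"
  assumes meas: "\<And>n. continuous_on {0<..<1} (f n)" "continuous_on {0<..<1} g"
    and sums: "\<And>t. 0 < t \<Longrightarrow> t < 1 \<Longrightarrow> (\<lambda>n. f n t) sums g t"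
    and bound: "\<And>t n. 0 < t \<Longrightarrow> t < 1 \<Longrightarrow> (\<Sum>k<n. norm (f k t)) \<le> B"
  shows "(\<lambda>n. LBINT t:{0<..<1}. f n t) sums (LBINT t:{0<..<1}. g t)"
proof -
  let ?I = "{0<..<1 :: real}"
  have m [measurable]: "(\<lambda>t. indicator ?I t *\<^sub>R h t) \<in> borel_measurable borel"
    if "continuous_on ?I h" for h :: "real \<Rightarrow> complex"
    using that by (intro borel_measurable_continuous_on_indicator) auto
  have int: "integrable lborel (\<lambda>t. indicator ?I t *\<^sub>R f n t)" for n
  proof (rule integrableI_bounded_set[where A = ?I and B = B])
    show "AE t in lborel. t \<in> ?I \<longrightarrow> norm (indicator ?I t *\<^sub>R f n t) \<le> B"
    proof (intro AE_I2 impI)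
      fix t :: real assume t: "t \<in> ?I"
      have "norm (f n t) \<le> (\<Sum>k<Suc n. norm (f k t))"
        by (simp add: sum_nonneg)
      also have "\<dots> \<le> B" using bound[of t "Suc n"] t by simp
      finally show "norm (indicator ?I t *\<^sub>R f n t) \<le> B" using t by simp
    qed
  qed (use m[OF meas(1)] in auto)
  have "(\<lambda>N. LBINT t. (\<Sum>n<N. indicator ?I t *\<^sub>R f n t)) \<longlonglongrightarrow> (LBINT t. indicator ?I t *\<^sub>R g t)"
  proof (rule integral_dominated_convergence)
    show "integrable lborel (\<lambda>t. indicator ?I t *\<^sub>R B)"
      by (rule integrableI_bounded_set[where A = ?I and B = "\<bar>B\<bar>"]) auto
    show "AE t in lborel. (\<lambda>N. \<Sum>n<N. indicator ?I t *\<^sub>R f n t) \<longlonglongrightarrow> indicator ?I t *\<^sub>R g t"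
      using sums by (auto simp: sums_def indicator_def)
    show "AE t in lborel. norm (\<Sum>n<N. indicator ?I t *\<^sub>R f n t) \<le> indicator ?I t *\<^sub>R B" for N
      using bound[of _ N] by (auto simp: indicator_def intro: order_trans[OF norm_sum])
    show "(\<lambda>t. indicator ?I t *\<^sub>R g t) \<in> borel_measurable lborel"
      using m[OF meas(2)] by simp
    show "(\<lambda>t. \<Sum>n<N. indicator ?I t *\<^sub>R f n t) \<in> borel_measurable lborel" for N
      using m[OF meas(1)] by (intro borel_measurable_sum) simp
  qed
  also have "(\<lambda>N. LBINT t. (\<Sum>n<N. indicator ?I t *\<^sub>R f n t)) =
      (\<lambda>N. \<Sum>n<N. LBINT t. indicator ?I t *\<^sub>R f n t)"
    by (intro ext Bochner_Integration.integral_sum int)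
  finally show ?thesis
    by (simp add: sums_def set_lebesgue_integral_def)
qed

theorem theorem4:
  fixes x y \<nu> p :: complex
  assumes "Re p > 0"
  shows "(\<lambda>n. pochhammer y n / fact n * ext_Beta \<nu> (x + of_nat n) 1 p) sums
           ext_Beta \<nu> x (1 - y) p"
proof -
  define K where "K = (\<lambda>t::real. besselK (\<nu> + 1 / 2) (p / of_real (t * (1 - t))))"
  \<comment> \<open>The integrand with second parameter 1, since \<open>1 - 3 / 2 = - 1 / 2\<close>.
    Passing to \<open>x + n\<close> multiplies it by \<open>t ^ n\<close>, and passing to
    \<open>1 - y\<close> by \<open>(1 - t) powr (- y)\<close>.\<close>
  define F where "F = (\<lambda>t::real. of_real t powr (x - 3 / 2) * of_real (1 - t) powr (- 1 / 2) * K t)"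
  define f where "f = (\<lambda>n t. pochhammer y n / fact n * (of_real t ^ n * F t))"
  define g where "g = (\<lambda>t::real. of_real (1 - t) powr (- y) * F t)"
  \<comment> \<open>The partial fraction keeps the argument on the ray through \<open>p\<close> and
    later splits the decay into one factor per endpoint.\<close>
  have arg: "p / of_real (t * (1 - t)) = p * of_real (1 / t + 1 / (1 - t))"
    and arg_ge: "1 / t + 1 / (1 - t) \<ge> 1" if "0 < t" "t < 1" for t :: real
  proof -
    have "1 / t + 1 / (1 - t) = 1 / (t * (1 - t))"
      using that by (simp add: field_simps)
    thus "p / of_real (t * (1 - t)) = p * of_real (1 / t + 1 / (1 - t))" by simp
    have "1 / t \<ge> 1" "1 / (1 - t) \<ge> 0" using that by simp_all
    thus "1 / t + 1 / (1 - t) \<ge> 1" by linarith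
  qed
  have pos: "Re (p * of_real (1 / t + 1 / (1 - t))) > 0" if "0 < t" "t < 1" for t
    using assms arg_ge[OF that] by simp
  have K_eq: "K t = besselK_integral (\<nu> + 1 / 2) (p * of_real (1 / t + 1 / (1 - t)))"
    if "0 < t" "t < 1" for t
    unfolding K_def arg[OF that] by (rule besselK_eq_integral[OF pos[OF that]])
  \<comment> \<open>Continuity is obtained from the integral, which is differentiable in its
    argument.\<close>
  have contK: "continuous_on {0<..<1} K"
  proof -
    have "isCont (besselK_integral (\<nu> + 1 / 2)) z" if "Re z > 0" for z
      by (rule DERIV_isCont[OF DERIV_besselK_integral[OF that]])
    hence "continuous_on {z. Re z > 0} (besselK_integral (\<nu> + 1 / 2))"
      by (intro continuous_at_imp_continuous_on) simp
    hence "continuous_on {0<..<1} (\<lambda>t. besselK_integral (\<nu> + 1 / 2) (p * of_real (1 / t + 1 / (1 - t))))"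
    proof (rule continuous_on_compose2)
      show "continuous_on {0<..<1} (\<lambda>t. p * of_real (1 / t + 1 / (1 - t)))"
        by (intro continuous_intros) auto
      show "(\<lambda>t. p * of_real (1 / t + 1 / (1 - t))) ` {0<..<1} \<subseteq> {z. Re z > 0}"
        unfolding image_subset_iff by (intro ballI CollectI pos) auto
    qed
    thus ?thesis
      by (rule continuous_on_eq) (rule K_eq[symmetric], auto)
  qed
  have cont_powr: "continuous_on {0<..<1} (\<lambda>t. complex_of_real t powr a)"
      "continuous_on {0<..<1} (\<lambda>t. complex_of_real (1 - t) powr a)" for a
    by (intro continuous_on_powr_complex continuous_on_of_real continuous_on_diff continuous_on_const
        continuous_on_id; force simp: complex_nonpos_Reals_iff)+
  have contF: "continuous_on {0<..<1} F"
    unfolding F_def by (intro continuous_on_mult cont_powr contK)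
  obtain C where C: "C \<ge> 0" "\<And>r. r \<ge> 1 \<Longrightarrow> norm (besselK_integral (\<nu> + 1 / 2) (p * of_real r)) \<le> C * exp (- Re p * r)"
    using besselK_integral_decay[OF assms] by blast
  obtain M1 where M1: "M1 \<ge> 0" "\<And>t. 0 < t \<Longrightarrow> t < 1 \<Longrightarrow> t powr (Re x - 3 / 2) * exp (- Re p / t) \<le> M1"
    using powr_exp_inverse_bounded[OF assms] by blast
  \<comment> \<open>This bound is used with \<open>1 - t\<close> in place of \<open>t\<close>; its
    exponent joins the \<open>- 1 / 2\<close> of \<open>F\<close> to the \<open>- norm y\<close> of
    the majorant series.\<close>
  obtain M2 where M2: "M2 \<ge> 0" "\<And>t. 0 < t \<Longrightarrow> t < 1 \<Longrightarrow> t powr (- 1 / 2 - norm y) * exp (- Re p / t) \<le> M2"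
    using powr_exp_inverse_bounded[OF assms] by blast
  have "(\<lambda>n. LBINT t:{0<..<1}. f n t) sums (LBINT t:{0<..<1}. g t)"
  proof (rule sums_LBINT_unit_interval_bounded[where B = "C * M1 * M2"])
    show "continuous_on {0<..<1} (f n)" for n
      unfolding f_def by (intro continuous_on_mult continuous_on_power continuous_on_of_real
          continuous_on_const continuous_on_id contF)
    show "continuous_on {0<..<1} g"
      unfolding g_def by (intro continuous_on_mult cont_powr contF)
    fix t :: real assume t: "0 < t" "t < 1"
    show "(\<lambda>n. f n t) sums g t"
      using sums_mult2[OF pochhammer_powser_sums[OF t], of y "F t"] by (simp add: f_def g_def mult_ac)
    fix n
    \<comment> \<open>Replacing \<open>y\<close> by \<open>norm y\<close> makes all coefficients
      non-negative, so the partial sums stay below the full sum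
      \<open>(1 - t) powr (- norm y)\<close>.\<close>
    have "(\<Sum>k<n. norm (f k t)) \<le> (\<Sum>k<n. pochhammer (norm y) k / fact k * t ^ k * norm (F t))"
      using t by (intro sum_mono)
        (auto simp: f_def norm_mult norm_divide norm_power mult.assoc
          intro!: mult_right_mono divide_right_mono norm_pochhammer_le)
    also have "\<dots> = (\<Sum>k<n. pochhammer (norm y) k / fact k * t ^ k) * norm (F t)"
      by (simp add: sum_distrib_right)
    also have "\<dots> \<le> (1 - t) powr (- norm y) * norm (F t)"
    proof (intro mult_right_mono)
      note s = pochhammer_powser_sums_real[OF t, of "norm y"]
      have "(\<Sum>k<n. pochhammer (norm y) k / fact k * t ^ k) \<le> (\<Sum>k. pochhammer (norm y) k / fact k * t ^ k)"
        using t s order_trans[OF norm_ge_zero norm_pochhammer_le[of y]]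
        by (intro sum_le_suminf mult_nonneg_nonneg divide_nonneg_nonneg) (simp_all add: sums_iff)
      with s show "(\<Sum>k<n. pochhammer (norm y) k / fact k * t ^ k) \<le> (1 - t) powr (- norm y)"
        by (simp add: sums_iff)
    qed simp
    also have "\<dots> = (1 - t) powr (- norm y) * (t powr (Re x - 3 / 2) * (1 - t) powr (- 1 / 2) * norm (K t))"
    proof -
      have "norm (complex_of_real r powr a) = r powr Re a" if "r > 0" for r a
        using that by (simp add: norm_powr_real_powr)
      from this[of t] this[of "1 - t"] t show ?thesis
        unfolding F_def norm_mult by (simp del: of_real_diff)
    qed
    also have "\<dots> \<le> (1 - t) powr (- norm y) * (t powr (Re x - 3 / 2) * (1 - t) powr (- 1 / 2) *
        (C * exp (- Re p * (1 / t + 1 / (1 - t)))))"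
      unfolding K_eq[OF t] by (intro mult_left_mono C arg_ge t) auto
    \<comment> \<open>One exponential is paired with the singularity at 0, the other with that at
      1.\<close>
    also have "\<dots> = C * (t powr (Re x - 3 / 2) * exp (- Re p / t)) *
        ((1 - t) powr (- 1 / 2 - norm y) * exp (- Re p / (1 - t)))"
    proof -
      have "(1 - t) powr (- 1 / 2 - norm y) = (1 - t) powr (- norm y) * (1 - t) powr (- 1 / 2)"
        unfolding powr_add[symmetric] by (rule arg_cong) simp
      moreover have "exp (- Re p * (1 / t + 1 / (1 - t))) = exp (- Re p / t) * exp (- Re p / (1 - t))"
        unfolding exp_add[symmetric] by (rule arg_cong) (simp add: ring_distribs)
      ultimately show ?thesis by (simp only: mult_ac)
    qed
    also have "\<dots> \<le> C * M1 * M2"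
      using t by (intro mult_mono M1 M2 C mult_nonneg_nonneg order_refl) auto
    finally show "(\<Sum>k<n. norm (f k t)) \<le> C * M1 * M2" .
  qed
  hence "(\<lambda>n. csqrt (2 * p / of_real pi) * (LBINT t:{0<..<1}. f n t)) sums
      (csqrt (2 * p / of_real pi) * (LBINT t:{0<..<1}. g t))"
    by (rule sums_mult)
  moreover have "csqrt (2 * p / of_real pi) * (LBINT t:{0<..<1}. g t) = ext_Beta \<nu> x (1 - y) p"
  proof -
    have "g t = of_real t powr (x - 3 / 2) * of_real (1 - t) powr (1 - y - 3 / 2) * K t"
      if "t \<in> {0<..<1}" for t
    proof -
      have "of_real (1 - t) powr (1 - y - 3 / 2) = of_real (1 - t) powr (- y) * of_real (1 - t) powr (- 1 / 2)"
        unfolding powr_add[symmetric] by (rule arg_cong) simp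
      thus ?thesis unfolding g_def F_def by (simp only: mult_ac)
    qed
    hence "(LBINT t:{0<..<1}. g t) =
        (LBINT t:{0<..<1}. of_real t powr (x - 3 / 2) * of_real (1 - t) powr (1 - y - 3 / 2) * K t)"
      by (intro set_lebesgue_integral_cong allI impI) simp_all
    thus ?thesis
      unfolding ext_Beta_def K_def by (simp only:)
  qed
  moreover have "csqrt (2 * p / of_real pi) * (LBINT t:{0<..<1}. f n t) =
      pochhammer y n / fact n * ext_Beta \<nu> (x + of_nat n) 1 p" for n
  proof -
    have "of_real t ^ n * F t = of_real t powr (x + of_nat n - 3 / 2) * of_real (1 - t) powr (1 - 3 / 2) * K t"
      if "t \<in> {0<..<1}" for t
    proof -
      have "of_real t powr (x + of_nat n - 3 / 2) = of_real t powr (x - 3 / 2) * of_real t powr of_nat n"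
        unfolding powr_add[symmetric] by (rule arg_cong) simp
      moreover have "complex_of_real t powr of_nat n = of_real t ^ n"
        using that by (intro powr_nat') auto
      moreover have "1 - 3 / 2 = (- 1 / 2 :: complex)" by simp
      ultimately show ?thesis unfolding F_def by (simp only: mult_ac)
    qed
    hence "(LBINT t:{0<..<1}. of_real t ^ n * F t) = (LBINT t:{0<..<1}.
        of_real t powr (x + of_nat n - 3 / 2) * of_real (1 - t) powr (1 - 3 / 2) * K t)"
      by (intro set_lebesgue_integral_cong allI impI) simp_all
    hence "pochhammer y n / fact n * ext_Beta \<nu> (x + of_nat n) 1 p =
        pochhammer y n / fact n * (csqrt (2 * p / of_real pi) * (LBINT t:{0<..<1}. of_real t ^ n * F t))"
      unfolding ext_Beta_def K_def by (simp only:)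
    also have "\<dots> = csqrt (2 * p / of_real pi) * (LBINT t:{0<..<1}. f n t)"
      unfolding f_def set_integral_mult_right by (simp only: mult_ac)
    finally show ?thesis ..
  qed
  ultimately show ?thesis by (simp only:)
qed

end
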